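(* Let $N$ be odd, let $J$ be a persymmetric Jacobi matrix of size $(N+1)\times(N+1)$ with real entries and nonzero off-diagonal entries and associated orthonormal polynomials $\chi_n$, and let $0<\theta<2\pi$. Let $\tilde J=VJV$ be its isospectral deformation with associated orthonormal polynomials $\tilde\chi_n$ (all as defined in the context). Then the polynomials $\tilde\chi_n(x)$, $n=0,1,\dots,N$, are expressed in terms of the polynomials $\chi_n(x)$ as follows: $$\tilde\chi_n(x)=\begin{cases}\chi_n(x), & \text{if } n\le\frac{N-1}{2},\\[1mm] \dfrac{1}{\cos2\theta}\,\chi_n(x)-\dfrac{\sin2\theta}{\cos2\theta}\,\chi_{N-n}(x), & \text{if } n>\frac{N-1}{2}.\end{cases}$$
   Context: Rows and columns are indexed by $0,\dots,N$. $J$ is the real symmetric tridiagonal matrix with diagonal entries $J_{nn}=b_n$ ($n=0,\dots,N$) and off-diagonal entries $J_{n-1,n}=J_{n,n-1}=a_n\neq 0$ ($n=1,\dots,N$); by convention $a_0=a_{N+1}=0$. It is persymmetric, i.e. it commutes with the reflection $e_n\mapsto e_{N-n}$ of the canonical basis $e_0,\dots,e_N$: $b_{N-i}=b_i$ and $a_{N+1-i}=a_i$. The orthonormal polynomials $\chi_n$ of $J$ are defined by $\chi_{-1}=0$, $\chi_0=1$, $a_{n+1}\chi_{n+1}(x)+b_n\chi_n(x)+a_n\chi_{n-1}(x)=x\chi_n(x)$. For $N$ odd, $V$ is the $(N+1)\times(N+1)$ matrix with $V_{nn}=\sin\theta$ for $n\le\frac{N-1}{2}$, $V_{nn}=-\sin\theta$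 for $n\ge\frac{N+1}{2}$, $V_{n,N-n}=\cos\theta$ for all $n$, and all other entries $0$. It satisfies $V=V^T$ and $V^2=I$. The matrix $\tilde J=VJV$ is again symmetric tridiagonal with the same spectrum as $J$; write $\tilde b_n=\tilde J_{nn}$ and $\tilde a_n=\tilde J_{n-1,n}$. Its entries coincide with those of $J$ except $\tilde a_{(N+1)/2}=a_{(N+1)/2}\cos 2\theta$ and $\tilde b_{(N\mp1)/2}=b_{(N-1)/2}\pm a_{(N+1)/2}\sin 2\theta$. The orthonormal polynomials $\tilde\chi_n$ of $\tilde J$ satisfy $\tilde a_{n+1}\tilde\chi_{n+1}(x)+\tilde b_n\tilde\chi_n(x)+\tilde a_n\tilde\chi_{n-1}(x)=x\tilde\chi_n(x)$ with initial conditions $\tilde\chi_{-1}=0$, $\tilde\chi_0=1$. *)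

theory Defs
  imports Complex_Main "Jordan_Normal_Form.Matrix" "HOL-Computational_Algebra.Polynomial"
begin

text \<open>All matrices are of size \<open>N + 1\<close>, with rows and columns indexed by \<open>0, \<dots>, N\<close>.
  For a tridiagonal matrix \<open>A\<close>, the paper's coefficients are \<open>b\<^sub>n = A $$ (n, n)\<close> for \<open>n \<le> N\<close> and
  \<open>a\<^sub>n = A $$ (n - 1, n)\<close> for \<open>1 \<le> n \<le> N\<close>.\<close>

definition jacobi_matrix :: "nat \<Rightarrow> real mat \<Rightarrow> bool" where
  "jacobi_matrix N J \<longleftrightarrow>
     J \<in> carrier_mat (N + 1) (N + 1) \<and>
     transpose_mat J = J \<and>
     (\<forall>i\<le>N. \<forall>j\<le>N. (i + 1 < j \<or> j + 1 < i) \<longrightarrow> J $$ (i, j) = 0) \<and>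
     (\<forall>n\<in>{1..N}. J $$ (n - 1, n) \<noteq> 0)"

definition reflection_mat :: "nat \<Rightarrow> real mat" where
  "reflection_mat N = mat (N + 1) (N + 1) (\<lambda>(i, j). if i + j = N then 1 else 0)"

definition persymmetric :: "nat \<Rightarrow> real mat \<Rightarrow> bool" where
  "persymmetric N J \<longleftrightarrow> J * reflection_mat N = reflection_mat N * J"

text \<open>The recurrence is an identity of polynomials and is required for \<open>n = 0, \<dots>, N - 1\<close>,
  which is what determines \<open>p 0, \<dots>, p N\<close>; nothing is required of \<open>p n\<close> for \<open>n > N\<close>.
  The equation with \<open>n = N\<close> and \<open>a\<^bsub>N+1\<^esub> = 0\<close> is left out: it is not a polynomial identity, but
  holds exactly at the eigenvalues.  The case distinction encodes \<open>\<chi>\<^bsub>-1\<^esub> = 0\<close>.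
  If one of the \<open>a\<^sub>n\<close> with \<open>1 \<le> n \<le> N\<close> vanishes, no such family exists.\<close>

definition orthonormal_polys :: "nat \<Rightarrow> real mat \<Rightarrow> (nat \<Rightarrow> real poly) \<Rightarrow> bool" where
  "orthonormal_polys N A p \<longleftrightarrow>
     p 0 = 1 \<and>
     (\<forall>n<N. smult (A $$ (n, n + 1)) (p (n + 1)) + smult (A $$ (n, n)) (p n)
              + (if n = 0 then 0 else smult (A $$ (n - 1, n)) (p (n - 1)))
            = [:0, 1:] * p n)"

text \<open>For odd \<open>N\<close> the diagonal and the antidiagonal \<open>i + j = N\<close> are disjoint.\<close>

definition V_mat :: "nat \<Rightarrow> real \<Rightarrow> real mat" where
  "V_mat N \<theta> = mat (N + 1) (N + 1) (\<lambda>(i, j).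
     if i = j then (if i \<le> (N - 1) div 2 then sin \<theta> else - sin \<theta>)
     else if i + j = N then cos \<theta>
     else 0)"

definition isospectral_deformation :: "nat \<Rightarrow> real \<Rightarrow> real mat \<Rightarrow> real mat" where
  "isospectral_deformation N \<theta> J = V_mat N \<theta> * J * V_mat N \<theta>"

fun recurrence_poly :: "real mat \<Rightarrow> nat \<Rightarrow> real poly" where
  "recurrence_poly A 0 = 1"
| "recurrence_poly A (Suc 0) = smult (1 / A $$ (0, 1)) [:- A $$ (0, 0), 1:]"
| "recurrence_poly A (Suc (Suc n)) = smult (1 / A $$ (Suc n, Suc (Suc n)))
     ([:- A $$ (Suc n, Suc n), 1:] * recurrence_poly A (Suc n)
      - smult (A $$ (n, Suc n)) (recurrence_poly A n))"

lemma orthonormal_polys_exist: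
  assumes "\<forall>n\<in>{1..N}. A $$ (n - 1, n) \<noteq> 0"
  shows "orthonormal_polys N A (recurrence_poly A)"
proof -
  have "smult (A $$ (n, n + 1)) (recurrence_poly A (n + 1)) + smult (A $$ (n, n)) (recurrence_poly A n)
          + (if n = 0 then 0 else smult (A $$ (n - 1, n)) (recurrence_poly A (n - 1)))
        = [:0, 1:] * recurrence_poly A n" if "n < N" for n
  proof -
    have nz: "A $$ (n, Suc n) \<noteq> 0" using assms that by force
    show ?thesis
    proof (cases n)
      case 0
      then show ?thesis using nz by simp
    next
      case (Suc m)
      have "smult (A $$ (n, Suc n)) (recurrence_poly A (Suc n))
          = [:- A $$ (n, n), 1:] * recurrence_poly A n - smult (A $$ (m, n)) (recurrence_poly A m)"
        using nz Suc by (simp only: recurrence_poly.simps smult_smult) simp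
      then show ?thesis using Suc by (simp add: algebra_simps)
    qed
  qed
  then show ?thesis unfolding orthonormal_polys_def by simp
qed

lemma orthonormal_polys_unique:
  assumes nz: "\<forall>n\<in>{1..N}. A $$ (n - 1, n) \<noteq> 0"
    and p: "orthonormal_polys N A p" and q: "orthonormal_polys N A q" and "n \<le> N"
  shows "p n = q n"
  using \<open>n \<le> N\<close>
proof (induction n rule: less_induct)
  case (less n)
  show ?case
  proof (cases n)
    case 0
    then show ?thesis using p q by (simp add: orthonormal_polys_def)
  next
    case (Suc m)
    have m: "m < N" using Suc less.prems by simp
    have eq: "p m = q m" "p (m - 1) = q (m - 1)" using less Suc by auto
    have ne: "A $$ (m, m + 1) \<noteq> 0" using nz m by force
    have "smult (A $$ (m, m + 1)) (p (m + 1)) = smult (A $$ (m, m + 1)) (q (m + 1))"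
      using p q m eq unfolding orthonormal_polys_def by (metis add_right_cancel)
    then have "smult (1 / A $$ (m, m + 1)) (smult (A $$ (m, m + 1)) (p (m + 1)))
        = smult (1 / A $$ (m, m + 1)) (smult (A $$ (m, m + 1)) (q (m + 1)))" by (rule arg_cong)
    then show ?thesis using ne Suc by simp
  qed
qed

end

theory Submission
  imports Defs
begin

text \<open>Since \<open>J\<close> commutes with the reflection, conjugation by \<open>V\<close> changes \<open>J\<close> only in the central
  \<open>2 \<times> 2\<close> block.  Below the centre both families obey the same recurrence; above it, persymmetry
  makes \<open>\<chi>\<^bsub>N-n\<^esub>\<close> a second solution of the recurrence of \<open>\<chi>\<^sub>n\<close>, and the two central equations fix
  the coefficients of the linear combination.  If \<open>cos 2\<theta> = 0\<close>, the deformed recurrence has no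
  solution for reasons of degree, so that case is vacuous.\<close>

section \<open>Entries of the deformed matrix\<close>

text \<open>For odd \<open>N\<close> the index \<open>i\<close> never equals \<open>N - i\<close>,
  so the nested case distinction splits into a sum of two Kronecker deltas. In this form products
  with \<open>V_mat\<close> reduce to delta sums.\<close>

lemma V_mat_index:
  assumes "odd N" "i \<le> N" "k \<le> N"
  shows "V_mat N \<theta> $$ (i, k) = (if k = i then (if i \<le> (N - 1) div 2 then sin \<theta> else - sin \<theta>) else 0)
    + (if k = N - i then cos \<theta> else 0)"
proof -
  have "i \<noteq> N - i" using assms by presburger
  then show ?thesis using assms by (auto simp: V_mat_def)
qed

lemma persymmetric_index:
  assumes "persymmetric N J" "J \<in> carrier_mat (N + 1) (N + 1)" "i \<le> N" "j \<le> N"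
  shows "J $$ (N - i, j) = J $$ (i, N - j)"
proof -
  have "(J * reflection_mat N) $$ (i, j) = (\<Sum>k<N + 1. J $$ (i, k) * (if k = N - j then 1 else 0))"
    using assms by (auto simp: reflection_mat_def scalar_prod_def lessThan_atLeast0 intro!: sum.cong)
  also have "\<dots> = (\<Sum>k<N + 1. if k = N - j then J $$ (i, k) else 0)"
    by (rule sum.cong) auto
  also have "\<dots> = J $$ (i, N - j)" by (subst sum.delta) auto
  finally have 1: "(J * reflection_mat N) $$ (i, j) = J $$ (i, N - j)" .
  have "(reflection_mat N * J) $$ (i, j) = (\<Sum>k<N + 1. (if k = N - i then 1 else 0) * J $$ (k, j))"
    using assms by (auto simp: reflection_mat_def scalar_prod_def lessThan_atLeast0 intro!: sum.cong)
  also have "\<dots> = (\<Sum>k<N + 1. if k = N - i then J $$ (k, j) else 0)"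
    by (rule sum.cong) auto
  also have "\<dots> = J $$ (N - i, j)" by (subst sum.delta) auto
  finally show ?thesis using 1 assms(1) by (simp add: persymmetric_def)
qed

lemma V_mat_mult_index:
  assumes "odd N" "J \<in> carrier_mat (N + 1) (N + 1)" "i \<le> N" "j \<le> N"
  shows "(V_mat N \<theta> * J) $$ (i, j) = (if i \<le> (N - 1) div 2 then sin \<theta> else - sin \<theta>) * J $$ (i, j)
    + cos \<theta> * J $$ (N - i, j)" (is "_ = ?d * _ + _")
proof -
  have "(V_mat N \<theta> * J) $$ (i, j) = (\<Sum>k<N + 1. V_mat N \<theta> $$ (i, k) * J $$ (k, j))"
    using assms by (simp add: V_mat_def scalar_prod_def lessThan_atLeast0)
  also have "\<dots> = (\<Sum>k<N + 1. (if k = i then ?d * J $$ (k, j) else 0)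
      + (if k = N - i then cos \<theta> * J $$ (k, j) else 0))"
    by (rule sum.cong) (use assms in \<open>auto simp: V_mat_index algebra_simps\<close>)
  also have "\<dots> = ?d * J $$ (i, j) + cos \<theta> * J $$ (N - i, j)"
    unfolding sum.distrib using assms by (simp del: sum.lessThan_Suc)
  finally show ?thesis .
qed

lemma mult_V_mat_index:
  assumes "odd N" "J \<in> carrier_mat (N + 1) (N + 1)" "i \<le> N" "j \<le> N"
  shows "(J * V_mat N \<theta>) $$ (i, j) = (if j \<le> (N - 1) div 2 then sin \<theta> else - sin \<theta>) * J $$ (i, j)
    + cos \<theta> * J $$ (i, N - j)" (is "_ = ?d * _ + _")
proof -
  have sym: "V_mat N \<theta> $$ (k, j) = V_mat N \<theta> $$ (j, k)" if "k \<le> N" for k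
    using that assms by (auto simp: V_mat_def)
  have "(J * V_mat N \<theta>) $$ (i, j) = (\<Sum>k<N + 1. J $$ (i, k) * V_mat N \<theta> $$ (k, j))"
    using assms by (simp add: V_mat_def scalar_prod_def lessThan_atLeast0)
  also have "\<dots> = (\<Sum>k<N + 1. (if k = j then ?d * J $$ (i, k) else 0)
      + (if k = N - j then cos \<theta> * J $$ (i, k) else 0))"
    by (rule sum.cong) (use assms in \<open>auto simp: sym V_mat_index algebra_simps\<close>)
  also have "\<dots> = ?d * J $$ (i, j) + cos \<theta> * J $$ (i, N - j)"
    unfolding sum.distrib using assms by (simp del: sum.lessThan_Suc)
  finally show ?thesis .
qed

text \<open>With \<open>d\<close> the signed diagonal of \<open>V_mat\<close>, persymmetry collapses
  the four terms of the product to \<open>J $$ (i, j)\<close> with coefficient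
  \<open>d i * d j + cos \<theta> * cos \<theta>\<close> and \<open>J $$ (i, N - j)\<close> with
  coefficient \<open>cos \<theta> * (d i + d j)\<close>. Equal signs give 1 and plus or minus
  \<open>sin (2 * \<theta>)\<close>; opposite signs give \<open>cos (2 * \<theta>)\<close> and
  0.\<close>

lemma isospectral_deformation_index:
  assumes "odd N" "J \<in> carrier_mat (N + 1) (N + 1)" "persymmetric N J" "i \<le> N" "j \<le> N"
  shows "isospectral_deformation N \<theta> J $$ (i, j) =
    (if i \<le> (N - 1) div 2 \<and> j \<le> (N - 1) div 2 then J $$ (i, j) + sin (2 * \<theta>) * J $$ (i, N - j)
     else if (N - 1) div 2 < i \<and> (N - 1) div 2 < j then J $$ (i, j) - sin (2 * \<theta>) * J $$ (i, N - j)
     else cos (2 * \<theta>) * J $$ (i, j))"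
proof -
  have VJ: "V_mat N \<theta> * J \<in> carrier_mat (N + 1) (N + 1)"
    by (intro mult_carrier_mat[OF _ assms(2)]) (simp add: V_mat_def)
  have refl: "J $$ (N - i, j) = J $$ (i, N - j)" "J $$ (N - i, N - j) = J $$ (i, j)"
    using persymmetric_index[OF assms(3,2,4), of j] persymmetric_index[OF assms(3,2,4), of "N - j"]
      assms(5) by auto
  have pyth: "sin \<theta> * sin \<theta> + cos \<theta> * cos \<theta> = 1"
    by (simp flip: power2_eq_square)
  define d where "d k = (if k \<le> (N - 1) div 2 then sin \<theta> else - sin \<theta>)" for k
  define x y where "x = J $$ (i, j)" and "y = J $$ (i, N - j)"
  have "isospectral_deformation N \<theta> J $$ (i, j)
      = d j * (d i * x + cos \<theta> * y) + cos \<theta> * (d i * y + cos \<theta> * x)"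
    unfolding isospectral_deformation_def
    using assms
    by (simp add: mult_V_mat_index[OF assms(1) VJ] V_mat_mult_index refl d_def x_def y_def
        del: One_nat_def)
  also have "\<dots> = (d i * d j + cos \<theta> * cos \<theta>) * x + cos \<theta> * (d i + d j) * y"
    by (simp add: algebra_simps)
  finally show ?thesis
    using pyth unfolding d_def x_def y_def sin_double cos_double power2_eq_square
    by (simp add: mult.commute mult.left_commute)
qed

section \<open>Degrees and the pointwise recurrence\<close>

text \<open>Multiplication by the variable raises the degree by one, while the other terms of the
  recurrence stay below. Nonvanishing is carried through the induction because
  \<open>degree_mult_eq\<close> needs it.\<close>

lemma degree_orthonormal_polys:
  assumes nz: "\<forall>n\<in>{1..N}. A $$ (n - 1, n) \<noteq> 0" and p: "orthonormal_polys N A p" and "n \<le> N"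
  shows "degree (p n) = n \<and> p n \<noteq> 0"
  using \<open>n \<le> N\<close>
proof (induction n rule: less_induct)
  case (less n)
  show ?case
  proof (cases n)
    case 0
    then show ?thesis using p by (simp add: orthonormal_polys_def)
  next
    case (Suc m)
    let ?r = "smult (A $$ (m, m)) (p m) + (if m = 0 then 0 else smult (A $$ (m - 1, m)) (p (m - 1)))"
    have m: "m < N" using Suc less.prems by simp
    have ne: "A $$ (m, m + 1) \<noteq> 0" using nz m by force
    have pm: "degree (p m) = m" "p m \<noteq> 0" and pm1: "degree (p (m - 1)) = m - 1"
      using less Suc by auto
    have eq: "smult (A $$ (m, m + 1)) (p n) = [:0, 1:] * p m - ?r"
      using p m Suc unfolding orthonormal_polys_def by (simp add: algebra_simps)
    have "degree ?r \<le> m"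
      by (intro degree_add_le order.trans[OF degree_smult_le])
        (use pm pm1 in \<open>auto intro: order.trans[OF degree_smult_le]\<close>)
    moreover have deg: "degree ([:0, 1:] * p m) = Suc m" using pm by (subst degree_mult_eq) auto
    ultimately have "degree ([:0, 1:] * p m - ?r) = Suc m"
      using degree_add_eq_left[of "- ?r" "[:0, 1:] * p m"]
      by (simp only: degree_minus uminus_add_conv_diff diff_conv_add_uminus)
    then have "degree (p n) = Suc m" using eq ne by (metis degree_smult_eq)
    then show ?thesis using Suc by auto
  qed
qed

text \<open>Real polynomials are determined by their values, so the recurrence can be handled by
  real arithmetic at a fixed \<open>x\<close>.\<close>

lemma orthonormal_polys_poly_iff:
  "orthonormal_polys N A p \<longleftrightarrow> p 0 = 1 \<and> (\<forall>n<N. \<forall>x. A $$ (n, n + 1) * poly (p (n + 1)) x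
    + A $$ (n, n) * poly (p n) x + (if n = 0 then 0 else A $$ (n - 1, n) * poly (p (n - 1)) x)
    = x * poly (p n) x)"
proof -
  have "smult (A $$ (n, n + 1)) (p (n + 1)) + smult (A $$ (n, n)) (p n)
              + (if n = 0 then 0 else smult (A $$ (n - 1, n)) (p (n - 1))) = [:0, 1:] * p n \<longleftrightarrow>
    (\<forall>x. A $$ (n, n + 1) * poly (p (n + 1)) x
    + A $$ (n, n) * poly (p n) x + (if n = 0 then 0 else A $$ (n - 1, n) * poly (p (n - 1)) x)
    = x * poly (p n) x)" for n
    unfolding poly_eq_poly_eq_iff[symmetric] fun_eq_iff by simp
  then show ?thesis unfolding orthonormal_polys_def by simp
qed

section \<open>Deformed polynomials in terms of the original ones\<close>

theorem proposition4p2: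
  fixes N n :: nat and J :: "real mat" and \<theta> :: real
    and \<chi> \<chi>' :: "nat \<Rightarrow> real poly"
  assumes "odd N"
    and "jacobi_matrix N J"
    and "persymmetric N J"
    and "0 < \<theta>" and "\<theta> < 2 * pi"
    and "orthonormal_polys N J \<chi>"
    and "orthonormal_polys N (isospectral_deformation N \<theta> J) \<chi>'"
    and "n \<le> N"
  shows "\<chi>' n =
    (if n \<le> (N - 1) div 2 then \<chi> n
     else smult (1 / cos (2 * \<theta>)) (\<chi> n)
            - smult (sin (2 * \<theta>) / cos (2 * \<theta>)) (\<chi> (N - n)))"
proof -
  define m where "m = (N - 1) div 2"
  have N: "N = 2 * m + 1" using \<open>odd N\<close> unfolding m_def by presburger
  define K where "K = isospectral_deformation N \<theta> J"
  define c where "c = cos (2 * \<theta>)"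
  define s where "s = sin (2 * \<theta>)"
  have sc: "s * s + c * c = 1" unfolding c_def s_def by (simp flip: power2_eq_square)
  have J: "J \<in> carrier_mat (N + 1) (N + 1)"
    using assms(2) unfolding jacobi_matrix_def by simp
  have tri: "J $$ (i, j) = 0" if "i + 1 < j \<or> j + 1 < i" "i \<le> N" "j \<le> N" for i j
    using assms(2) that unfolding jacobi_matrix_def by auto
  have nz: "\<forall>n\<in>{1..N}. J $$ (n - 1, n) \<noteq> 0"
    using assms(2) unfolding jacobi_matrix_def by auto
  have sym: "J $$ (i, j) = J $$ (j, i)" if "i \<le> N" "j \<le> N" for i j
  proof -
    have "transpose_mat J $$ (i, j) = J $$ (j, i)" using J that by simp
    then show ?thesis using assms(2) unfolding jacobi_matrix_def by simp
  qed
  have refl: "J $$ (N - i, N - j) = J $$ (i, j)" if "i \<le> N" "j \<le> N" for i j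
    using persymmetric_index[OF assms(3) J, of i "N - j"] that by simp
  have K: "K $$ (i, j) = (if i \<le> m \<and> j \<le> m then J $$ (i, j) + s * J $$ (i, N - j)
     else if m < i \<and> m < j then J $$ (i, j) - s * J $$ (i, N - j) else c * J $$ (i, j))"
    if "i \<le> N" "j \<le> N" for i j
    using isospectral_deformation_index[OF assms(1) J assms(3) that, of \<theta>]
    unfolding K_def m_def c_def s_def .
  \<comment> \<open>The term \<open>J $$ (i, N - j)\<close> in \<open>K\<close> vanishes by
    tridiagonality unless it lies near the centre: for \<open>j = i + 1\<close> its indices differ
    by \<open>2 * |m - i|\<close>, which is at least 2 when \<open>i\<close> is not
    \<open>m\<close>. On the diagonal the difference is odd, and equals 1 only for
    \<open>i = m\<close> and \<open>i = m + 1\<close>.\<close>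
  have K_off: "K $$ (i, i + 1) = (if i = m then c else 1) * J $$ (i, i + 1)" if "i < N" for i
  proof (cases "i = m")
    case False
    then have "J $$ (i, N - (i + 1)) = 0" using that N by (intro tri) linarith+
    then show ?thesis using that False N by (auto simp: K)
  qed (use N in \<open>simp add: K\<close>)
  have K_diag: "K $$ (i, i) = J $$ (i, i)" if "i \<le> N" "i \<noteq> m" "i \<noteq> m + 1" for i
  proof -
    have "J $$ (i, N - i) = 0" using that N by (intro tri) linarith+
    then show ?thesis using that by (simp add: K)
  qed
  define a where "a = J $$ (m, m + 1)"
  have a: "a \<noteq> 0" using nz[rule_format, of "m + 1"] N unfolding a_def by simp
  have K_m: "K $$ (m, m) = J $$ (m, m) + s * a"
    and K_m1: "K $$ (m + 1, m + 1) = J $$ (m, m) - s * a"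
    using N refl[of m m] sym[of "m + 1" m] unfolding a_def by (auto simp: K)
  have rec: "J $$ (i, i + 1) * poly (\<chi> (i + 1)) x + J $$ (i, i) * poly (\<chi> i) x
      + (if i = 0 then 0 else J $$ (i - 1, i) * poly (\<chi> (i - 1)) x) = x * poly (\<chi> i) x"
    if "i < N" for i x
    using assms(6) that unfolding orthonormal_polys_poly_iff by blast
  have rec': "K $$ (i, i + 1) * poly (\<chi>' (i + 1)) x + K $$ (i, i) * poly (\<chi>' i) x
      + (if i = 0 then 0 else K $$ (i - 1, i) * poly (\<chi>' (i - 1)) x) = x * poly (\<chi>' i) x"
    if "i < N" for i x
    using assms(7) that unfolding K_def[symmetric] orthonormal_polys_poly_iff by blast
  have \<chi>0: "\<chi> 0 = 1" using assms(6) by (simp add: orthonormal_polys_def)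
  have K_off': "K $$ (i - 1, i) = (if i = m + 1 then c else 1) * J $$ (i - 1, i)"
    if "i \<noteq> 0" "i \<le> N" for i
    using K_off[of "i - 1"] that by (cases i) auto
  have J_nz: "J $$ (i - 1, i) \<noteq> 0" if "i \<noteq> 0" "i \<le> N" for i
    using nz that by simp
  \<comment> \<open>Truncation at \<open>m\<close> involves only equations with index below
    \<open>m\<close>, hence no altered entry of \<open>K\<close>. The off-diagonal entries involved
    are nonzero whatever \<open>c\<close> is, so uniqueness applies before \<open>c\<close> is known
    to be nonzero.\<close>
  have \<chi>_low: "orthonormal_polys m K \<chi>"
    unfolding orthonormal_polys_poly_iff
  proof (intro conjI allI impI \<chi>0)
    fix i x assume "i < m"
    then show "K $$ (i, i + 1) * poly (\<chi> (i + 1)) x + K $$ (i, i) * poly (\<chi> i) x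
        + (if i = 0 then 0 else K $$ (i - 1, i) * poly (\<chi> (i - 1)) x) = x * poly (\<chi> i) x"
      using rec[of i x] N K_off'[of i] by (simp only: K_off K_diag split: if_splits) auto
  qed
  have \<chi>'_low: "orthonormal_polys m K \<chi>'"
    using assms(7) N unfolding K_def[symmetric] orthonormal_polys_def by simp
  have low: "\<chi>' i = \<chi> i" if "i \<le> m" for i
    by (rule orthonormal_polys_unique[OF _ \<chi>'_low \<chi>_low that]) (use N K_off' J_nz in auto)
  have c: "c \<noteq> 0"
  proof
    assume "c = 0"
    \<comment> \<open>For \<open>c = 0\<close> the term with \<open>\<chi>' (m + 1)\<close> drops
      out of the deformed equation at \<open>m\<close>. Since both families agree up to
      \<open>m\<close>, subtracting it from the original equation isolates
      \<open>\<chi> (m + 1)\<close>.\<close>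
    have "a * poly (\<chi> (m + 1)) x = a * (s * poly (\<chi> m) x)" for x
    proof -
      define R where "R = (if m = 0 then 0 else J $$ (m - 1, m) * poly (\<chi> (m - 1)) x)"
      have "a * poly (\<chi> (m + 1)) x + J $$ (m, m) * poly (\<chi> m) x + R = x * poly (\<chi> m) x"
        using rec[of m x] N by (simp add: a_def R_def)
      moreover have R: "(if m = 0 then 0 else K $$ (m - 1, m) * poly (\<chi>' (m - 1)) x) = R"
        using N K_off'[of m] by (simp add: low R_def)
      moreover have "(J $$ (m, m) + s * a) * poly (\<chi> m) x + R = x * poly (\<chi> m) x"
        using rec'[of m x] N K_off[of m] \<open>c = 0\<close> unfolding K_m low[OF order.refl] R by simp
      ultimately show ?thesis unfolding ring_distribs by (simp only: mult_ac)
    qed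
    then have "\<chi> (m + 1) = smult s (\<chi> m)"
      using a by (simp add: poly_eq_poly_eq_iff[symmetric] fun_eq_iff)
    then show False
      using degree_orthonormal_polys[OF nz assms(6), of m]
        degree_orthonormal_polys[OF nz assms(6), of "m + 1"] N
      by (simp split: if_splits)
  qed
  \<comment> \<open>The claimed formula is taken as a candidate; once it satisfies the recurrence of
    \<open>K\<close>, uniqueness identifies it with \<open>\<chi>'\<close>.\<close>
  define q where "q i = (if i \<le> m then \<chi> i
    else smult (1 / c) (\<chi> i) - smult (s / c) (\<chi> (N - i)))" for i
  have "orthonormal_polys N K q"
    unfolding orthonormal_polys_poly_iff
  proof (intro conjI allI impI)
    show "q 0 = 1" by (simp add: q_def \<chi>0)
    fix i x assume "i < N"
    define f where "f k = poly (\<chi> k) x" for k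
    have qf: "poly (q k) x = (if k \<le> m then f k else (f k - s * f (N - k)) / c)" for k
      by (simp add: q_def f_def diff_divide_distrib)
    note recf = rec[of _ x, folded f_def]
    \<comment> \<open>The third term is kept general: at \<open>m + 1\<close> the lower neighbour
      belongs to the lower half and carries no denominator, whereas further up it does.\<close>
    have divide: "u * (y / c) + v * (z / c) + t = x * (w / c)"
      if "u * y + v * z + c * t = x * w" for u v t y z w
    proof -
      have "(u * y + v * z + c * t) / c = x * w / c" using that by simp
      then show ?thesis using c by (simp add: add_divide_distrib)
    qed
    consider "i < m" | "i = m" | "i = m + 1" | "m + 1 < i" by linarith
    then show "K $$ (i, i + 1) * poly (q (i + 1)) x + K $$ (i, i) * poly (q i) x
        + (if i = 0 then 0 else K $$ (i - 1, i) * poly (q (i - 1)) x) = x * poly (q i) x"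
    proof cases
      case 1
      then show ?thesis
        using recf[of i] N K_off[of i] K_off'[of i] K_diag[of i] by (auto simp: qf)
    next
      case 2
      \<comment> \<open>The factor \<open>c\<close> of the central off-diagonal entry cancels the
        denominator of \<open>q (m + 1)\<close>, and the remaining \<open>- s * a * f m\<close>
        cancels the shift in \<open>K_m\<close>.\<close>
      have "N - (m + 1) = m" using N by simp
      then have "K $$ (m, m + 1) * poly (q (m + 1)) x = a * (f (m + 1) - s * f m)"
        using K_off[of m] N c by (simp add: qf a_def)
      moreover have "(if m = 0 then 0 else K $$ (m - 1, m) * poly (q (m - 1)) x)
          = (if m = 0 then 0 else J $$ (m - 1, m) * f (m - 1))"
        using K_off'[of m] N by (simp add: qf)
      moreover have "a * f (m + 1) + J $$ (m, m) * f m
          + (if m = 0 then 0 else J $$ (m - 1, m) * f (m - 1)) = x * f m"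
        using recf[of m] N by (simp add: a_def)
      ultimately show ?thesis
        unfolding 2 K_m qf[of m] by (simp only: order.refl if_True) (simp add: algebra_simps)
    next
      case 3
      define u where "u = J $$ (m + 1, m + 2)"
      have m: "0 < m" using 3 \<open>i < N\<close> N by simp
      have u: "J $$ (m - 1, m) = u" and d: "J $$ (m + 1, m + 1) = J $$ (m, m)"
        using refl[of "m + 2" "m + 1"] sym[of "m + 2" "m + 1"] refl[of m m] N m
        unfolding u_def by (auto simp: numeral_2_eq_2)
      have r1: "u * f (m + 2) + J $$ (m, m) * f (m + 1) + a * f m = x * f (m + 1)"
        using recf[of "m + 1"] N m d by (simp add: u_def a_def)
      have r2: "a * f (m + 1) + J $$ (m, m) * f m + u * f (m - 1) = x * f m"
        using recf[of m] N m u by (simp add: a_def)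
      \<comment> \<open>This is the equation at \<open>m + 1\<close> minus \<open>s\<close> times
        the one at \<open>m\<close>; the leftover multiple of \<open>a * f m\<close> vanishes by
        \<open>sc\<close>.\<close>
      have "u * (f (m + 2) - s * f (m - 1)) + (J $$ (m, m) - s * a) * (f (m + 1) - s * f m)
          + c * (c * a * f m)
        = (u * f (m + 2) + J $$ (m, m) * f (m + 1) + a * f m)
          - s * (a * f (m + 1) + J $$ (m, m) * f m + u * f (m - 1)) + (s * s + c * c - 1) * (a * f m)"
        by (simp add: algebra_simps)
      also have "\<dots> = x * (f (m + 1) - s * f m)"
        unfolding r1 r2 sc by (simp add: algebra_simps)
      finally have "u * ((f (m + 2) - s * f (m - 1)) / c)
          + (J $$ (m, m) - s * a) * ((f (m + 1) - s * f m) / c)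
          + c * a * f m = x * ((f (m + 1) - s * f m) / c)"
        by (rule divide)
      moreover have "N - (m + 2) = m - 1" "N - (m + 1) = m" using N by auto
      ultimately show ?thesis
        using 3 \<open>i < N\<close> K_off[of "m + 1"] K_off[of m] K_m1 N
        by (simp add: qf u_def a_def)
    next
      case 4
      \<comment> \<open>The equation of \<chi> at the mirror index \<open>k\<close>, read through
        \<open>J_refl\<close>, has the coefficients of the equation at \<open>i\<close> with the two
        neighbours exchanged. Here \<open>0 < k\<close>, so \<open>k - 1\<close> is a genuine
        index.\<close>
      define k where "k = N - i"
      have k: "0 < k" "k < m" "N - (i + 1) = k - 1" "N - (i - 1) = k + 1" "N - i = k"
        using 4 \<open>i < N\<close> N unfolding k_def by auto
      have J_refl: "J $$ (k, k + 1) = J $$ (i - 1, i)" "J $$ (k, k) = J $$ (i, i)"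
        "J $$ (k - 1, k) = J $$ (i, i + 1)"
        using refl[of i "i - 1"] refl[of i i] refl[of "i + 1" i] sym[of i "i - 1"]
          sym[of "i + 1" i] k 4 \<open>i < N\<close> by auto
      have r1: "J $$ (i, i + 1) * f (i + 1) + J $$ (i, i) * f i + J $$ (i - 1, i) * f (i - 1) = x * f i"
        using recf[of i] 4 \<open>i < N\<close> by simp
      have r2: "J $$ (i - 1, i) * f (k + 1) + J $$ (i, i) * f k + J $$ (i, i + 1) * f (k - 1) = x * f k"
        using recf[of k] k(1,2) N unfolding J_refl by simp
      have "J $$ (i, i + 1) * (f (i + 1) - s * f (k - 1)) + J $$ (i, i) * (f i - s * f k)
          + c * (J $$ (i - 1, i) * ((f (i - 1) - s * f (k + 1)) / c))
        = (J $$ (i, i + 1) * f (i + 1) + J $$ (i, i) * f i + J $$ (i - 1, i) * f (i - 1))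
          - s * (J $$ (i - 1, i) * f (k + 1) + J $$ (i, i) * f k + J $$ (i, i + 1) * f (k - 1))"
        using c by (simp add: algebra_simps diff_divide_distrib)
      also have "\<dots> = x * (f i - s * f k)"
        unfolding r1 r2 by (simp add: algebra_simps)
      finally have "J $$ (i, i + 1) * ((f (i + 1) - s * f (k - 1)) / c)
          + J $$ (i, i) * ((f i - s * f k) / c)
          + J $$ (i - 1, i) * ((f (i - 1) - s * f (k + 1)) / c) = x * ((f i - s * f k) / c)"
        by (rule divide)
      moreover have "\<not> i - 1 \<le> m" using 4 by simp
      ultimately show ?thesis
        using 4 \<open>i < N\<close> K_off[of i] K_off'[of i] K_diag[of i] k by (simp add: qf)
    qed
  qed
  \<comment> \<open>Uniqueness needs nonzero off-diagonal entries of \<open>K\<close>; the central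
    one is \<open>c * a\<close>, which is where \<open>c\<close> being nonzero enters.\<close>
  then have "\<chi>' n = q n"
    using assms(7,8) c K_off' J_nz
    by (intro orthonormal_polys_unique[of N K]) (auto simp: K_def[symmetric])
  then show ?thesis unfolding q_def m_def c_def s_def .
qed

end
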